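(* Let $r\ge 1$, let $\mathbf a=(a_1,\ldots,a_r)$ be a sequence of positive integers, and let $D$ be a positive common multiple of $a_1,\ldots,a_r$. For every integer $n\geq 0$ we have $p_{\mathbf a}(n)=0$ if and only if $n<a_1j_1+\cdots+a_rj_r$ for all integers $0\leq j_1\leq \frac{D}{a_1}-1,\ldots, 0\leq j_r\leq \frac{D}{a_r}-1$ with $a_1j_1+\cdots+a_rj_r \equiv n \ (\mathrm{mod}\ D)$.
   Context: $p_{\mathbf a}(n)$ (the restricted partition function) is the number of integer solutions $(x_1,\ldots,x_r)$ of $\sum_{i=1}^r a_ix_i=n$ with all $x_i\ge 0$. *)

theory Defs
  imports "HOL-Number_Theory.Cong"
begin

text \<open>
  A sequence \<open>(a\<^sub>1, \<dots>, a\<^sub>r)\<close> is a list of length \<open>r\<close>, indexed from \<open>0\<close>.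
\<close>

definition lincomb :: "nat list \<Rightarrow> nat list \<Rightarrow> nat" where
  "lincomb a x = (\<Sum>i<length a. a ! i * x ! i)"

text \<open>
  Nonnegative integer solutions are lists over \<^typ>\<open>nat\<close>. The set counted below is finite when
  all entries of \<open>a\<close> are positive; otherwise it may be infinite, and \<^const>\<open>card\<close> is then \<open>0\<close>
  by convention.
\<close>

definition restricted_partition :: "nat list \<Rightarrow> nat \<Rightarrow> nat" where
  "restricted_partition a n = card {x. length x = length a \<and> lincomb a x = n}"

end

theory Submission
  imports Defs
begin

text \<open>
  The period \<open>D\<close> allows every coordinate to be moved by multiples of \<open>D / a\<^sub>i\<close> at the price of
  changing \<open>\<Sum> a\<^sub>i x\<^sub>i\<close> by a multiple of \<open>D\<close>. Hence a solution of \<open>\<Sum> a\<^sub>i x\<^sub>i = n\<close> can be reduced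
  coordinatewise to its residues modulo \<open>D / a\<^sub>i\<close>, which gives a point of the box with a value at
  most \<open>n\<close> in the same residue class modulo \<open>D\<close> (\<open>lincomb_residues_cong\<close>,
  \<open>lincomb_residues_le\<close>). Conversely, if a point of the box has a value of the form \<open>n - k D\<close> with
  \<open>k \<ge> 0\<close>, then the deficit \<open>k D\<close> is a multiple of \<open>a\<^sub>1\<close> and can be put entirely into the first
  coordinate (\<open>lincomb_add_first\<close>). So a solution exists iff some point of the box congruent to \<open>n\<close>
  has a value at most \<open>n\<close>; and since there are only finitely many solutions, their number vanishes
  exactly when there is none (\<open>restricted_partition_eq_0_iff\<close>).
\<close>

lemma finite_lincomb_solutions:
  assumes "\<forall>i<length a. a ! i > 0"
  shows "finite {x. length x = length a \<and> lincomb a x = n}"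
proof (rule finite_subset)
  show "finite {x. set x \<subseteq> {..n} \<and> length x = length a}"
    by (rule finite_lists_length_eq) simp
  have "x ! i \<le> lincomb a x" if "i < length a" for x i
  proof -
    have "x ! i \<le> a ! i * x ! i"
      using assms that by (simp add: Suc_le_eq)
    also have "\<dots> \<le> lincomb a x"
      unfolding lincomb_def using that by (intro member_le_sum) auto
    finally show ?thesis .
  qed
  then show "{x. length x = length a \<and> lincomb a x = n} \<subseteq>
      {x. set x \<subseteq> {..n} \<and> length x = length a}"
    by (auto simp: in_set_conv_nth)
qed

lemma restricted_partition_eq_0_iff:
  assumes "\<forall>i<length a. a ! i > 0"
  shows "restricted_partition a n = 0 \<longleftrightarrow> \<not> (\<exists>x. length x = length a \<and> lincomb a x = n)"
  using finite_lincomb_solutions[OF assms, of n] by (auto simp: restricted_partition_def)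

lemma lincomb_add_first:
  assumes "a \<noteq> []" and "length x = length a"
  shows "lincomb a (x[0 := x ! 0 + m]) = lincomb a x + a ! 0 * m"
proof -
  obtain l where "length a = Suc l"
    using assms(1) by (cases a) auto
  then show ?thesis
    using assms(2) by (simp add: lincomb_def sum.lessThan_Suc_shift algebra_simps del: sum.lessThan_Suc)
qed

definition residues_mod_period :: "nat \<Rightarrow> nat list \<Rightarrow> nat list \<Rightarrow> nat list" where
  "residues_mod_period D a x = map (\<lambda>i. x ! i mod (D div a ! i)) [0..<length a]"

lemma length_residues_mod_period [simp]: "length (residues_mod_period D a x) = length a"
  by (simp add: residues_mod_period_def)

lemma nth_residues_mod_period [simp]:
  "i < length a \<Longrightarrow> residues_mod_period D a x ! i = x ! i mod (D div a ! i)"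
  by (simp add: residues_mod_period_def)

lemma lincomb_residues_le: "lincomb a (residues_mod_period D a x) \<le> lincomb a x"
  unfolding lincomb_def by (intro sum_mono) simp

text \<open>
  Termwise, multiplying the residue of \<open>x\<^sub>i\<close> modulo \<open>D / a\<^sub>i\<close> by \<open>a\<^sub>i\<close> gives the residue of
  \<open>a\<^sub>i x\<^sub>i\<close> modulo \<open>a\<^sub>i (D / a\<^sub>i) = D\<close>.
\<close>

lemma lincomb_residues_cong:
  assumes "\<forall>i<length a. a ! i dvd D"
  shows "[lincomb a (residues_mod_period D a x) = lincomb a x] (mod D)"
  unfolding lincomb_def
proof (rule cong_sum)
  fix i assume "i \<in> {..<length a}"
  then have "a ! i * residues_mod_period D a x ! i = (a ! i * x ! i) mod D"
    using assms by (simp add: mult_mod_right)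
  then show "[a ! i * residues_mod_period D a x ! i = a ! i * x ! i] (mod D)"
    by simp
qed

theorem corollary1p12:
  fixes r D n :: nat and a :: "nat list"
  assumes "r \<ge> 1"
    and "length a = r"
    and "\<forall>i<r. a ! i > 0"
    and "D > 0"
    and "\<forall>i<r. a ! i dvd D"
  shows "restricted_partition a n = 0 \<longleftrightarrow>
    (\<forall>j. length j = r \<and> (\<forall>i<r. j ! i \<le> D div a ! i - 1) \<and> [lincomb a j = n] (mod D)
      \<longrightarrow> n < lincomb a j)"
proof -
  have zero_iff: "restricted_partition a n = 0 \<longleftrightarrow> \<not> (\<exists>x. length x = r \<and> lincomb a x = n)"
    using restricted_partition_eq_0_iff assms(2,3) by simp
  show ?thesis
  proof
    assume "restricted_partition a n = 0"
    then have no_solution: "lincomb a x \<noteq> n" if "length x = r" for x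
      using zero_iff that by blast
    show "\<forall>j. length j = r \<and> (\<forall>i<r. j ! i \<le> D div a ! i - 1) \<and> [lincomb a j = n] (mod D)
      \<longrightarrow> n < lincomb a j"
    proof (intro allI impI, elim conjE, rule ccontr)
      fix j assume j: "length j = r" "[lincomb a j = n] (mod D)" "\<not> n < lincomb a j"
      then have "D dvd n - lincomb a j"
        using cong_altdef_nat[of "lincomb a j" n D] by (simp add: cong_sym_eq[of n])
      moreover have "a ! 0 dvd D"
        using assms(1,5) by simp
      ultimately obtain m where "n - lincomb a j = a ! 0 * m"
        using dvd_trans by (blast elim: dvdE)
      moreover have "a \<noteq> []"
        using assms(1,2) by auto
      ultimately have "lincomb a (j[0 := j ! 0 + m]) = n"
        using j assms(2) by (simp add: lincomb_add_first)
      then show False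
        using no_solution[of "j[0 := j ! 0 + m]"] j by simp
    qed
  next
    assume box: "\<forall>j. length j = r \<and> (\<forall>i<r. j ! i \<le> D div a ! i - 1) \<and>
      [lincomb a j = n] (mod D) \<longrightarrow> n < lincomb a j"
    have False if x: "lincomb a x = n" for x
    proof -
      let ?j = "residues_mod_period D a x"
      have "?j ! i \<le> D div a ! i - 1" if "i < r" for i
      proof -
        have "D div a ! i > 0"
          using assms(3-5) that by (simp add: div_greater_zero_iff dvd_imp_le)
        then have "x ! i mod (D div a ! i) < D div a ! i"
          by simp
        then show ?thesis
          using that assms(2) by simp
      qed
      moreover have "[lincomb a ?j = n] (mod D)"
        using lincomb_residues_cong assms(2,5) x by blast
      ultimately have "n < lincomb a ?j"
        using box assms(2) by simp
      then show False
        using lincomb_residues_le[of a D x] x by simp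
    qed
    then show "restricted_partition a n = 0"
      using zero_iff by blast
  qed
qed

end
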